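(* Let $R$ be a ring and let $I$ be a proper ideal of $R$ such that $\sqrt{0}\subseteq I$ and $\sqrt{0}$ is a prime ideal of $R$ (equivalently, a primary ideal of $R$). Then $I$ is a weakly $1$-absorbing prime ideal of $R$ if and only if $I$ is a $1$-absorbing prime ideal of $R$.
   Context: All rings are commutative with identity. $\sqrt{0}$ denotes the set of nilpotent elements of $R$. A proper ideal $I$ of a ring $R$ (i.e. $I\neq R$) is called $1$-absorbing prime if for all nonunit elements $a,b,c\in R$ with $abc\in I$, either $ab\in I$ or $c\in I$. A proper ideal $I$ of $R$ is called weakly $1$-absorbing prime if for all nonunit elements $a,b,c\in R$ with $0\neq abc\in I$, either $ab\in I$ or $c\in I$. *)

theory Defs
  imports "HOL-Algebra.Ideal"
begin

definition nilradical :: "('a, 'm) ring_scheme \<Rightarrow> 'a set" where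
  "nilradical R = {a \<in> carrier R. \<exists>n::nat. 0 < n \<and> a [^]\<^bsub>R\<^esub> n = \<zero>\<^bsub>R\<^esub>}"

definition proper_ideal :: "'a set \<Rightarrow> ('a, 'm) ring_scheme \<Rightarrow> bool" where
  "proper_ideal I R \<longleftrightarrow> ideal I R \<and> I \<noteq> carrier R"

definition primary_ideal :: "'a set \<Rightarrow> ('a, 'm) ring_scheme \<Rightarrow> bool" where
  "primary_ideal I R \<longleftrightarrow> proper_ideal I R \<and>
     (\<forall>a\<in>carrier R. \<forall>b\<in>carrier R. a \<otimes>\<^bsub>R\<^esub> b \<in> I \<longrightarrow>
        a \<in> I \<or> (\<exists>n::nat. 0 < n \<and> b [^]\<^bsub>R\<^esub> n \<in> I))"

definition nonunits :: "('a, 'm) ring_scheme \<Rightarrow> 'a set" where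
  "nonunits R = carrier R - Units R"

definition one_absorbing_prime :: "'a set \<Rightarrow> ('a, 'm) ring_scheme \<Rightarrow> bool" where
  "one_absorbing_prime I R \<longleftrightarrow> proper_ideal I R \<and>
     (\<forall>a\<in>nonunits R. \<forall>b\<in>nonunits R. \<forall>c\<in>nonunits R.
        a \<otimes>\<^bsub>R\<^esub> b \<otimes>\<^bsub>R\<^esub> c \<in> I \<longrightarrow> a \<otimes>\<^bsub>R\<^esub> b \<in> I \<or> c \<in> I)"

definition weakly_one_absorbing_prime :: "'a set \<Rightarrow> ('a, 'm) ring_scheme \<Rightarrow> bool" where
  "weakly_one_absorbing_prime I R \<longleftrightarrow> proper_ideal I R \<and>
     (\<forall>a\<in>nonunits R. \<forall>b\<in>nonunits R. \<forall>c\<in>nonunits R.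
        a \<otimes>\<^bsub>R\<^esub> b \<otimes>\<^bsub>R\<^esub> c \<noteq> \<zero>\<^bsub>R\<^esub> \<and> a \<otimes>\<^bsub>R\<^esub> b \<otimes>\<^bsub>R\<^esub> c \<in> I \<longrightarrow>
        a \<otimes>\<^bsub>R\<^esub> b \<in> I \<or> c \<in> I)"

end

theory Submission
  imports Defs
begin

text \<open>The weak and the full absorbing conditions differ only on triples of nonunits with
  product 0. If a prime ideal P lies inside I, such a triple is harmless: abc = 0 belongs to P, so
  ab or c belongs to P and hence to I. This is \<open>one_absorbing_prime_if_weakly\<close>, applied
  with P the nilradical. That prime and primary agree for the nilradical
  (\<open>primeideal_nilradical_iff_primary\<close>) comes from its being a radical ideal.\<close>

lemma (in cring) in_nilradical_if_pow_in_nilradical: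
  assumes b: "b \<in> carrier R" and n: "0 < (n::nat)" and bn: "b [^] n \<in> nilradical R"
  shows "b \<in> nilradical R"
proof -
  obtain m :: nat where "0 < m" "(b [^] n) [^] m = \<zero>"
    using bn unfolding nilradical_def by blast
  then have "0 < n * m" "b [^] (n * m) = \<zero>"
    using n b by (simp_all add: nat_pow_pow)
  then show ?thesis
    using b unfolding nilradical_def by blast
qed

lemma (in cring) primary_ideal_if_primeideal:
  assumes "primeideal I R"
  shows "primary_ideal I R"
proof -
  interpret primeideal I R by fact
  have "\<exists>n::nat. 0 < n \<and> b [^] n \<in> I" if "b \<in> I" for b
    \<comment> \<open>A prime ideal meets the primary condition with exponent 1.\<close>
    using that by (intro exI[of _ 1]) (simp add: a_Hcarr)
  then show ?thesis
    unfolding primary_ideal_def proper_ideal_def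
    using is_ideal I_notcarr I_prime by blast
qed

text \<open>If a power of b is nilpotent, so is b; the exponent in the primary condition can
  therefore be dropped, which leaves primality.\<close>

lemma (in cring) primeideal_nilradical_iff_primary:
  "primeideal (nilradical R) R \<longleftrightarrow> primary_ideal (nilradical R) R"
proof
  assume "primary_ideal (nilradical R) R"
  then have "ideal (nilradical R) R" "carrier R \<noteq> nilradical R"
    "\<forall>a\<in>carrier R. \<forall>b\<in>carrier R. a \<otimes> b \<in> nilradical R \<longrightarrow> a \<in> nilradical R \<or> b \<in> nilradical R"
    using in_nilradical_if_pow_in_nilradical
    unfolding primary_ideal_def proper_ideal_def by blast+
  then show "primeideal (nilradical R) R"
    by (intro primeidealI is_cring) auto
qed (rule primary_ideal_if_primeideal)

lemma weakly_one_absorbing_prime_if_one_absorbing_prime: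
  "one_absorbing_prime I R \<Longrightarrow> weakly_one_absorbing_prime I R"
  unfolding one_absorbing_prime_def weakly_one_absorbing_prime_def by blast

lemma (in cring) one_absorbing_prime_if_weakly:
  assumes P: "primeideal P R" and PI: "P \<subseteq> I"
    and weak: "weakly_one_absorbing_prime I R"
  shows "one_absorbing_prime I R"
proof -
  interpret P: primeideal P R by (rule P)
  have "a \<otimes> b \<in> I \<or> c \<in> I"
    if abc: "a \<in> nonunits R" "b \<in> nonunits R" "c \<in> nonunits R" "a \<otimes> b \<otimes> c \<in> I" for a b c
  proof (cases "a \<otimes> b \<otimes> c = \<zero>")
    case True
    have "a \<in> carrier R" "b \<in> carrier R" "c \<in> carrier R"
      using abc unfolding nonunits_def by auto
    moreover have "a \<otimes> b \<otimes> c \<in> P"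
      using True P.additive_subgroup_axioms additive_subgroup.zero_closed by fastforce
    \<comment> \<open>Primality is used on the two factors \<open>a \<otimes> b\<close> and
      \<open>c\<close>, which gives exactly the alternative that 1-absorbing asks for.\<close>
    ultimately have "a \<otimes> b \<in> P \<or> c \<in> P"
      using P.I_prime m_closed by blast
    with PI show ?thesis by blast
  next
    case False
    \<comment> \<open>For a nonzero product the weak condition is already the full one.\<close>
    with weak abc show ?thesis unfolding weakly_one_absorbing_prime_def by blast
  qed
  with weak show ?thesis
    unfolding one_absorbing_prime_def weakly_one_absorbing_prime_def by blast
qed

theorem theorem2p10:
  fixes R :: "('a, 'm) ring_scheme" and I :: "'a set"
  assumes "cring R"
    and "proper_ideal I R"
    and "nilradical R \<subseteq> I"
  shows "(primeideal (nilradical R) R \<longleftrightarrow> primary_ideal (nilradical R) R) \<and>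
    (primeideal (nilradical R) R \<longrightarrow>
      (weakly_one_absorbing_prime I R \<longleftrightarrow> one_absorbing_prime I R))"
  using cring.primeideal_nilradical_iff_primary[OF assms(1)]
    cring.one_absorbing_prime_if_weakly[OF assms(1) _ assms(3)]
    weakly_one_absorbing_prime_if_one_absorbing_prime
  by blast

end
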